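(* Let $\Gamma$ be a finitely generated group which admits an epimorphism $\pi \colon \Gamma \to \mathbb{Z}$, a finite set $S$ of generators and a subset $E_0$ of the set of all pairs $\{s,s'\}$ with elements in $S$, having the following properties: (a) the epimorphism $\pi$ maps every generator $s \in S$ to $1 \in \mathbb{Z}$, and (b) the combinatorial graph with vertex set $S$ and edge set $E_0$ is connected. For every edge $e = \{s,s'\} \in E_0$, let $G_e$ be the subgroup of $\Gamma$ generated by $\{s,s'\}$ and set $N_e = \ker \pi \cap G_e$. Then the union $\bigcup_{e \in E_0} N_e$ generates the kernel of $\pi$. *)

theory Defs
  imports "HOL-Algebra.Elementary_Groups" "Graph_Theory.Digraph_Component"
begin

text \<open>
  The undirected graph with vertex set \<open>V\<close> and edge set \<open>E\<close>, where an edge is an unordered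
  pair \<open>{u, v}\<close>, in the convention of \<open>Graph_Theory\<close>: each edge contributes both of the arcs
  \<open>(u, v)\<close> and \<open>(v, u)\<close>.
\<close>
definition undirected_graph :: "'a set \<Rightarrow> 'a set set \<Rightarrow> 'a pair_pre_digraph" where
  "undirected_graph V E = \<lparr>pverts = V, parcs = {(u, v). {u, v} \<in> E}\<rparr>"

end

theory Submission
  imports Defs
begin

text \<open>
  Let \<open>H\<close> be the subgroup generated by the \<open>N\<^sub>e\<close>. For an edge \<open>e = {s, s'}\<close> both \<open>s s'\<^sup>-\<^sup>1\<close> and
  \<open>s\<^sup>-\<^sup>1 s'\<close> lie in \<open>N\<^sub>e\<close>, so by connectedness \<open>s t\<^sup>-\<^sup>1\<close> and \<open>s\<^sup>-\<^sup>1 t\<close> lie in \<open>H\<close> for all \<open>s, t \<in> S\<close>.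
  Since \<open>N\<^sub>e\<close> is normalised by \<open>s \<in> e\<close>, writing \<open>t n t\<^sup>-\<^sup>1 = (t s\<^sup>-\<^sup>1) (s n s\<^sup>-\<^sup>1) (s t\<^sup>-\<^sup>1)\<close> shows that \<open>H\<close>
  is normal in \<open>\<Gamma>\<close>. All generators agree modulo \<open>H\<close>, so \<open>\<Gamma> / H\<close> is generated by the image of a
  single \<open>s \<in> S\<close>, and \<open>\<pi> s = 1\<close> forces \<open>H = ker \<pi>\<close>.
\<close>

text \<open>Cancellation rules for the simplifier: once \<open>m_assoc\<close> has bracketed a
  product to the right, \<open>x\<close> and \<open>inv x\<close> can be neighbours without forming
  a subterm.\<close>

lemma (in group) mult_inv_cancel_left:
  assumes "x \<in> carrier G" "y \<in> carrier G"
  shows "x \<otimes> (inv x \<otimes> y) = y" and "inv x \<otimes> (x \<otimes> y) = y"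
  using assms by (simp_all add: m_assoc [symmetric])

text \<open>Conjugation by \<open>g\<close> is a homomorphism, so the preimage of \<open>K\<close>
  under it is a subgroup, and a subgroup containing \<open>A\<close> contains all of
  \<open>generate G A\<close>.\<close>

lemma (in group) conjugate_generate_in_subgroup:
  assumes K: "subgroup K G" and A: "A \<subseteq> carrier G" and g: "g \<in> carrier G"
    and conj: "\<And>a. a \<in> A \<Longrightarrow> g \<otimes> a \<otimes> inv g \<in> K"
    and h: "h \<in> generate G A"
  shows "g \<otimes> h \<otimes> inv g \<in> K"
  using h
proof (induction h rule: generate.induct)
  case one
  then show ?case using g K by (simp add: subgroup.one_closed)
next
  case (incl a)
  then show ?case by (rule conj)
next
  case (inv a)
  have "g \<otimes> inv a \<otimes> inv g = inv (g \<otimes> a \<otimes> inv g)"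
    using inv g A by (auto simp: inv_mult_group m_assoc subset_iff)
  then show ?case using conj[OF inv] K by (simp add: subgroup.m_inv_closed)
next
  case (eng a b)
  have "g \<otimes> (a \<otimes> b) \<otimes> inv g = (g \<otimes> a \<otimes> inv g) \<otimes> (g \<otimes> b \<otimes> inv g)"
    using eng(1,2)[THEN generate_in_carrier[OF A]] g by (simp add: m_assoc mult_inv_cancel_left)
  then show ?case using eng.IH K by (simp add: subgroup.m_closed)
qed

text \<open>The elements that conjugate \<open>generate G A\<close> into itself are closed under
  products, but possibly not under inverses, since the image may be a proper subgroup. Hence one
  hypothesis for \<open>s\<close> and another for \<open>inv s\<close>.\<close>

lemma (in group) normal_generate_by_generators:
  assumes A: "A \<subseteq> carrier G" and S: "S \<subseteq> carrier G" and gen: "generate G S = carrier G"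
    and conj1: "\<And>s a. s \<in> S \<Longrightarrow> a \<in> A \<Longrightarrow> s \<otimes> a \<otimes> inv s \<in> generate G A"
    and conj2: "\<And>s a. s \<in> S \<Longrightarrow> a \<in> A \<Longrightarrow> inv s \<otimes> a \<otimes> s \<in> generate G A"
  shows "generate G A \<lhd> G"
proof -
  let ?H = "generate G A"
  have H: "subgroup ?H G" by (rule generate_is_subgroup[OF A])
  have "\<forall>h\<in>?H. g \<otimes> h \<otimes> inv g \<in> ?H" if "g \<in> generate G S" for g
    using that
  proof (induction g rule: generate.induct)
    case one
    then show ?case using generate_in_carrier[OF A] by simp
  next
    case (incl s)
    then show ?case
      using conjugate_generate_in_subgroup[OF H A] conj1 S by blast
  next
    case (inv s)
    have "inv s \<otimes> a \<otimes> inv (inv s) \<in> ?H" if "a \<in> A" for a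
      using conj2[OF inv that] inv S by auto
    then show ?case
      using conjugate_generate_in_subgroup[OF H A] inv S by blast
  next
    case (eng x y)
    have xy: "x \<in> carrier G" "y \<in> carrier G"
      using eng(1,2) gen by auto
    have "x \<otimes> y \<otimes> h \<otimes> inv (x \<otimes> y) = x \<otimes> (y \<otimes> h \<otimes> inv y) \<otimes> inv x" if "h \<in> ?H" for h
      using generate_in_carrier[OF A that] xy by (simp add: inv_mult_group m_assoc)
    then show ?case using eng.IH by simp
  qed
  then show ?thesis using H gen by (simp add: normal_inv_iff)
qed

text \<open>Modulo \<open>H\<close> every element of \<open>S\<close> equals \<open>t\<close>, so
  the image of \<open>generate G S\<close> lies in the cyclic group generated by that of
  \<open>t\<close>. The witness \<open>k\<close> built by the induction is minus the exponent sum of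
  a word for \<open>g\<close>.\<close>

lemma (in normal) generate_times_power:
  assumes S: "S \<subseteq> carrier G" and t: "t \<in> carrier G"
    and St: "\<And>s. s \<in> S \<Longrightarrow> s \<otimes> inv t \<in> H" "\<And>s. s \<in> S \<Longrightarrow> inv s \<otimes> t \<in> H"
    and g: "g \<in> generate G S"
  shows "\<exists>k::int. g \<otimes> t [^] k \<in> H"
  using g
proof (induction g rule: generate.induct)
  case one
  have "\<one> \<otimes> t [^] (0::int) \<in> H" by simp
  then show ?case by blast
next
  case (incl s)
  have "s \<otimes> t [^] (-1::int) \<in> H" using St(1)[OF incl] t by (simp add: int_pow_neg int_pow_1)
  then show ?case by blast
next
  case (inv s)
  have "inv s \<otimes> t [^] (1::int) \<in> H" using St(2)[OF inv] t by (simp add: int_pow_1)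
  then show ?case by blast
next
  case (eng x y)
  then obtain k l :: int where k: "x \<otimes> t [^] k \<in> H" and l: "y \<otimes> t [^] l \<in> H" by blast
  have xy: "x \<in> carrier G" "y \<in> carrier G"
    using eng(1,2) generate_in_carrier[OF S] by auto
  \<comment> \<open>By normality, \<open>y \<otimes> t [^] l\<close> may be conjugated by
    \<open>t [^] k\<close>; this cancels the power standing between \<open>x\<close> and
    \<open>y\<close> and puts it back at the right end.\<close>
  have "x \<otimes> t [^] k \<otimes> (inv (t [^] k) \<otimes> (y \<otimes> t [^] l) \<otimes> t [^] k) \<in> H"
    using k inv_op_closed1[OF _ l] t by simp
  moreover have "x \<otimes> t [^] k \<otimes> (inv (t [^] k) \<otimes> (y \<otimes> t [^] l) \<otimes> t [^] k)
      = x \<otimes> y \<otimes> t [^] (l + k)"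
    using xy t by (simp add: m_assoc int_pow_mult mult_inv_cancel_left)
  ultimately show ?case by auto
qed

text \<open>\<open>connected\<close> means strong connectedness of the symmetric closure. As
  \<open>{u, v} = {v, u}\<close>, the arc relation is already symmetric, so the closure adds no arcs
  and reachability is plain \<open>rtrancl\<close>.\<close>

lemma connected_undirected_graph_rtrancl:
  assumes "Digraph_Component.connected (with_proj (undirected_graph V E))"
    and "u \<in> V" "v \<in> V"
  shows "(u, v) \<in> {(x, y). {x, y} \<in> E}\<^sup>*"
proof -
  have "u \<rightarrow>\<^sup>*\<^bsub>with_proj (mk_symmetric (with_proj (undirected_graph V E)))\<^esub> v"
    using assms by (auto simp: connected_def strongly_connected_def undirected_graph_def)
  then have "(u, v) \<in> (parcs (mk_symmetric (with_proj (undirected_graph V E))))\<^sup>*"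
    by (auto dest: reachable_rtranclI)
  moreover have "parcs (mk_symmetric (with_proj (undirected_graph V E))) = {(x, y). {x, y} \<in> E}"
    by (auto simp: parcs_mk_symmetric undirected_graph_def insert_commute)
  ultimately show ?thesis by simp
qed

theorem theorem3p3:
  fixes \<Gamma> :: "('g, 'm) monoid_scheme"
    and \<pi> :: "'g \<Rightarrow> int"
    and S :: "'g set"
    and E\<^sub>0 :: "'g set set"
    and N :: "'g set \<Rightarrow> 'g set"
  assumes "group \<Gamma>"
    and "\<pi> \<in> epi \<Gamma> integer_group"
    and "finite S" and "S \<subseteq> carrier \<Gamma>" and "generate \<Gamma> S = carrier \<Gamma>"
    and "E\<^sub>0 \<subseteq> {{s, s'} | s s'. s \<in> S \<and> s' \<in> S}"
    and "\<forall>s\<in>S. \<pi> s = 1"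
    and "Digraph_Component.connected (with_proj (undirected_graph S E\<^sub>0))"
    and "\<And>e. e \<in> E\<^sub>0 \<Longrightarrow> N e = kernel \<Gamma> integer_group \<pi> \<inter> generate \<Gamma> e"
  shows "generate \<Gamma> (\<Union>e\<in>E\<^sub>0. N e) = kernel \<Gamma> integer_group \<pi>"
proof -
  interpret group_hom \<Gamma> integer_group \<pi>
    using assms(1,2) by (simp add: group_hom_def group_hom_axioms_def epi_def)
  note S = assms(4)
  let ?A = "\<Union>e\<in>E\<^sub>0. N e"
  let ?K = "kernel \<Gamma> integer_group \<pi>"
  let ?H = "generate \<Gamma> ?A"
  have pi_mult: "\<pi> (x \<otimes>\<^bsub>\<Gamma>\<^esub> y) = \<pi> x + \<pi> y" if "x \<in> carrier \<Gamma>" "y \<in> carrier \<Gamma>" for x y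
    using hom_mult[OF that] by simp
  have pi_inv: "\<pi> (inv\<^bsub>\<Gamma>\<^esub> x) = - \<pi> x" if "x \<in> carrier \<Gamma>" for x
    using hom_inv[OF that] by simp
  have K: "subgroup ?K \<Gamma>" by (rule subgroup_kernel)
  have K_iff: "x \<in> ?K \<longleftrightarrow> x \<in> carrier \<Gamma> \<and> \<pi> x = 0" for x
    by (simp add: kernel_def)
  have edge: "e \<subseteq> carrier \<Gamma>" "e \<subseteq> S" if "e \<in> E\<^sub>0" for e
    using that assms(4,6) by auto
  have A_K: "?A \<subseteq> ?K" using assms(9) by auto
  then have A: "?A \<subseteq> carrier \<Gamma>" by (auto simp: K_iff)
  have H: "subgroup ?H \<Gamma>" by (rule G.generate_is_subgroup[OF A])
  have H_K: "?H \<subseteq> ?K" by (rule G.generate_subgroup_incl[OF A_K K])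
  \<comment> \<open>Reduces membership in \<open>?H\<close> to two checks: being a word in the ends
    of one edge, and having \<pi>-value 0.\<close>
  have N_H: "x \<in> ?H" if "e \<in> E\<^sub>0" "x \<in> generate \<Gamma> e" "\<pi> x = 0" for e x
  proof -
    have "x \<in> N e"
      using that assms(9) G.generate_in_carrier[OF edge(1)[OF that(1)]] by (auto simp: K_iff)
    then show ?thesis using that(1) by (blast intro: generate.incl)
  qed
  have quot: "s \<otimes>\<^bsub>\<Gamma>\<^esub> inv\<^bsub>\<Gamma>\<^esub> t \<in> ?H \<and> inv\<^bsub>\<Gamma>\<^esub> s \<otimes>\<^bsub>\<Gamma>\<^esub> t \<in> ?H"
    if s: "s \<in> S" and t: "t \<in> S" for s t
  proof -
    have "(s, t) \<in> {(x, y). {x, y} \<in> E\<^sub>0}\<^sup>*"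
      using connected_undirected_graph_rtrancl[OF assms(8) s t] .
    then show ?thesis
    proof (induction rule: rtrancl_induct)
      case base
      then show ?case using s S H by (auto simp: subgroup.one_closed subset_iff)
    next
      case (step x y)
      then have e: "{x, y} \<in> E\<^sub>0" by simp
      then have xy: "x \<in> S" "y \<in> S" using edge(2) by auto
      have c: "s \<in> carrier \<Gamma>" "x \<in> carrier \<Gamma>" "y \<in> carrier \<Gamma>" using xy s S by auto
      \<comment> \<open>Both ends of the edge have \<pi>-value 1, so the values cancel.\<close>
      have "x \<otimes>\<^bsub>\<Gamma>\<^esub> inv\<^bsub>\<Gamma>\<^esub> y \<in> ?H" "inv\<^bsub>\<Gamma>\<^esub> x \<otimes>\<^bsub>\<Gamma>\<^esub> y \<in> ?H"
        by (rule N_H[OF e];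
            use c xy assms(7) in \<open>auto simp: pi_mult pi_inv intro!: generate.eng generate.inv
              intro: generate.incl\<close>)+
      \<comment> \<open>The quotients along a path from \<open>s\<close> telescope.\<close>
      then have "(s \<otimes>\<^bsub>\<Gamma>\<^esub> inv\<^bsub>\<Gamma>\<^esub> x) \<otimes>\<^bsub>\<Gamma>\<^esub> (x \<otimes>\<^bsub>\<Gamma>\<^esub> inv\<^bsub>\<Gamma>\<^esub> y) \<in> ?H"
        "(inv\<^bsub>\<Gamma>\<^esub> s \<otimes>\<^bsub>\<Gamma>\<^esub> x) \<otimes>\<^bsub>\<Gamma>\<^esub> (inv\<^bsub>\<Gamma>\<^esub> x \<otimes>\<^bsub>\<Gamma>\<^esub> y) \<in> ?H"
        using step.IH subgroup.m_closed[OF H] by blast+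
      moreover have "(s \<otimes>\<^bsub>\<Gamma>\<^esub> inv\<^bsub>\<Gamma>\<^esub> x) \<otimes>\<^bsub>\<Gamma>\<^esub> (x \<otimes>\<^bsub>\<Gamma>\<^esub> inv\<^bsub>\<Gamma>\<^esub> y) = s \<otimes>\<^bsub>\<Gamma>\<^esub> inv\<^bsub>\<Gamma>\<^esub> y"
        "(inv\<^bsub>\<Gamma>\<^esub> s \<otimes>\<^bsub>\<Gamma>\<^esub> x) \<otimes>\<^bsub>\<Gamma>\<^esub> (inv\<^bsub>\<Gamma>\<^esub> x \<otimes>\<^bsub>\<Gamma>\<^esub> y) = inv\<^bsub>\<Gamma>\<^esub> s \<otimes>\<^bsub>\<Gamma>\<^esub> y"
        using c by (simp_all add: G.m_assoc G.mult_inv_cancel_left)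
      ultimately show ?case by simp
    qed
  qed
  have conj: "t \<otimes>\<^bsub>\<Gamma>\<^esub> n \<otimes>\<^bsub>\<Gamma>\<^esub> inv\<^bsub>\<Gamma>\<^esub> t \<in> ?H \<and> inv\<^bsub>\<Gamma>\<^esub> t \<otimes>\<^bsub>\<Gamma>\<^esub> n \<otimes>\<^bsub>\<Gamma>\<^esub> t \<in> ?H"
    if t: "t \<in> S" and n: "n \<in> ?A" for t n
  proof -
    obtain e where e: "e \<in> E\<^sub>0" "n \<in> N e" using n by blast
    \<comment> \<open>An edge has the form \<open>{s, s'}\<close>, hence is nonempty. Conjugating
      \<open>n\<close> by an end of its own edge stays in the subgroup generated by \<open>e\<close>
      and keeps \<pi>-value 0.\<close>
    then obtain s where s: "s \<in> e" using assms(6) by blast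
    then have sS: "s \<in> S" using edge(2)[OF e(1)] by blast
    have ng: "n \<in> generate \<Gamma> e" "\<pi> n = 0" using e assms(9) by (auto simp: K_iff)
    have c: "s \<in> carrier \<Gamma>" "t \<in> carrier \<Gamma>" "n \<in> carrier \<Gamma>" using sS t n S A by auto
    have "s \<otimes>\<^bsub>\<Gamma>\<^esub> n \<otimes>\<^bsub>\<Gamma>\<^esub> inv\<^bsub>\<Gamma>\<^esub> s \<in> ?H" "inv\<^bsub>\<Gamma>\<^esub> s \<otimes>\<^bsub>\<Gamma>\<^esub> n \<otimes>\<^bsub>\<Gamma>\<^esub> s \<in> ?H"
      by (rule N_H[OF e(1)];
          use c ng s in \<open>auto simp: pi_mult pi_inv intro!: generate.eng generate.inv
            intro: generate.incl\<close>)+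
    then have "(t \<otimes>\<^bsub>\<Gamma>\<^esub> inv\<^bsub>\<Gamma>\<^esub> s) \<otimes>\<^bsub>\<Gamma>\<^esub> (s \<otimes>\<^bsub>\<Gamma>\<^esub> n \<otimes>\<^bsub>\<Gamma>\<^esub> inv\<^bsub>\<Gamma>\<^esub> s) \<otimes>\<^bsub>\<Gamma>\<^esub> (s \<otimes>\<^bsub>\<Gamma>\<^esub> inv\<^bsub>\<Gamma>\<^esub> t) \<in> ?H"
      "(inv\<^bsub>\<Gamma>\<^esub> t \<otimes>\<^bsub>\<Gamma>\<^esub> s) \<otimes>\<^bsub>\<Gamma>\<^esub> (inv\<^bsub>\<Gamma>\<^esub> s \<otimes>\<^bsub>\<Gamma>\<^esub> n \<otimes>\<^bsub>\<Gamma>\<^esub> s) \<otimes>\<^bsub>\<Gamma>\<^esub> (inv\<^bsub>\<Gamma>\<^esub> s \<otimes>\<^bsub>\<Gamma>\<^esub> t) \<in> ?H"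
      using quot[OF t sS] quot[OF sS t] subgroup.m_closed[OF H] by blast+
    moreover have "(t \<otimes>\<^bsub>\<Gamma>\<^esub> inv\<^bsub>\<Gamma>\<^esub> s) \<otimes>\<^bsub>\<Gamma>\<^esub> (s \<otimes>\<^bsub>\<Gamma>\<^esub> n \<otimes>\<^bsub>\<Gamma>\<^esub> inv\<^bsub>\<Gamma>\<^esub> s) \<otimes>\<^bsub>\<Gamma>\<^esub> (s \<otimes>\<^bsub>\<Gamma>\<^esub> inv\<^bsub>\<Gamma>\<^esub> t)
        = t \<otimes>\<^bsub>\<Gamma>\<^esub> n \<otimes>\<^bsub>\<Gamma>\<^esub> inv\<^bsub>\<Gamma>\<^esub> t"
      "(inv\<^bsub>\<Gamma>\<^esub> t \<otimes>\<^bsub>\<Gamma>\<^esub> s) \<otimes>\<^bsub>\<Gamma>\<^esub> (inv\<^bsub>\<Gamma>\<^esub> s \<otimes>\<^bsub>\<Gamma>\<^esub> n \<otimes>\<^bsub>\<Gamma>\<^esub> s) \<otimes>\<^bsub>\<Gamma>\<^esub> (inv\<^bsub>\<Gamma>\<^esub> s \<otimes>\<^bsub>\<Gamma>\<^esub> t)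
        = inv\<^bsub>\<Gamma>\<^esub> t \<otimes>\<^bsub>\<Gamma>\<^esub> n \<otimes>\<^bsub>\<Gamma>\<^esub> t"
      using c by (simp_all add: G.m_assoc G.mult_inv_cancel_left)
    ultimately show ?thesis by simp
  qed
  interpret normal ?H \<Gamma>
    using conj by (intro G.normal_generate_by_generators[OF A S assms(5)]) auto
  \<comment> \<open>Strong connectedness includes that there is at least one vertex.\<close>
  have "S \<noteq> {}"
    using assms(8) by (auto simp: connected_def strongly_connected_def undirected_graph_def)
  then obtain t where t: "t \<in> S" by blast
  then have tc: "t \<in> carrier \<Gamma>" using S by blast
  have "g \<in> ?H" if g: "g \<in> ?K" for g
  proof -
    have gc: "g \<in> carrier \<Gamma>" and g0: "\<pi> g = 0" using g by (auto simp: K_iff)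
    obtain k :: int where k: "g \<otimes>\<^bsub>\<Gamma>\<^esub> t [^]\<^bsub>\<Gamma>\<^esub> k \<in> ?H"
      using generate_times_power[OF S tc, of g] quot t gc assms(5) by blast
    \<comment> \<open>Since \<open>\<pi> g = 0\<close> and \<open>\<pi> t = 1\<close>, the left side
      equals \<open>k\<close>. So the power of \<open>t\<close> is trivial and \<open>g\<close>
      itself lies in \<open>?H\<close>.\<close>
    then have "\<pi> (g \<otimes>\<^bsub>\<Gamma>\<^esub> t [^]\<^bsub>\<Gamma>\<^esub> k) = 0" using H_K by (auto simp: K_iff)
    then have "k = 0"
      using gc g0 tc t assms(7) by (simp add: pi_mult hom_int_pow)
    then show ?thesis using k gc by simp
  qed
  then show ?thesis using H_K by blast
qed

end
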